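(* For any fixed integer $d\ge 1$, Signed Max Cut ATLB restricted to instances $(G,k)$ in which $G$ is a $d^*$-split graph admits a kernel with at most $4(d+1)k$ vertices. More precisely, for every instance $(G,k)$ of Signed Max Cut ATLB in which $G$ is a $d^*$-split graph, if $|V(G)|\ge 4(d+1)k$ then $(G,k)$ is a Yes-instance; hence the algorithm that answers Yes when $|V(G)|\ge 4(d+1)k$ and otherwise returns $(G,k)$ unchanged is a kernel with at most $4(d+1)k$ vertices.
   Context: A signed graph is a simple undirected graph in which each edge is labelled positive ($+$) or negative ($-$). A signed graph $G$ is balanced if there is a partition $(V_1,V_2)$ of $V(G)$ such that every edge with both endpoints in the same part is positive and every edge with endpoints in different parts is negative. For a signed graph $G$ with $n$ vertices and $m$ edges, Signed Max Cut ATLB is the problem: given a connected signed graph $G$ and a positive integer $k$ (the parameter), decide whether $G$ has a balanced subgraph with at least $\frac{m}{2}+\frac{n-1}{4}+\frac{k}{4}$ edges; the instance is a Yes-instance if so. For an integer $d\ge 1$, a graph $G=(V,E)$ is a $d^*$-split graph if $V$ can be partitioned into a clique $K$ and an independent set $I$ such that every vertex of $K$ has at least one neighbor in $I$ and every vertex of $I$ has degree at most $d$. *)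

theory Defs
  imports Complex_Main "HOL-Computational_Algebra.Polynomial"
begin

section \<open>Signed graphs\<close>

text \<open>Edges are two-element sets of vertices; the label of an edge is given by membership in
  \<open>pos\<close> or \<open>neg\<close>.\<close>

record 'a sgraph =
  verts :: "'a set"
  pos :: "'a set set"
  neg :: "'a set set"

definition edges :: "'a sgraph \<Rightarrow> 'a set set" where
  "edges G = pos G \<union> neg G"

definition signed_graph :: "'a sgraph \<Rightarrow> bool" where
  "signed_graph G \<longleftrightarrow> finite (verts G) \<and>
     (\<forall>e\<in>edges G. e \<subseteq> verts G \<and> card e = 2) \<and> pos G \<inter> neg G = {}"

definition subgraph :: "'a sgraph \<Rightarrow> 'a sgraph \<Rightarrow> bool" where
  "subgraph H G \<longleftrightarrow> signed_graph H \<and> verts H \<subseteq> verts G \<and> pos H \<subseteq> pos G \<and> neg H \<subseteq> neg G"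

definition connected_graph :: "'a sgraph \<Rightarrow> bool" where
  "connected_graph G \<longleftrightarrow> verts G \<noteq> {} \<and>
     (\<forall>u\<in>verts G. \<forall>v\<in>verts G. (u, v) \<in> {(x, y). {x, y} \<in> edges G}\<^sup>*)"

text \<open>Either part may be empty.\<close>

definition balanced :: "'a sgraph \<Rightarrow> bool" where
  "balanced G \<longleftrightarrow> (\<exists>V1 V2. V1 \<union> V2 = verts G \<and> V1 \<inter> V2 = {} \<and>
     (\<forall>e\<in>edges G. (e \<subseteq> V1 \<or> e \<subseteq> V2 \<longrightarrow> e \<in> pos G) \<and>
                  (\<not> e \<subseteq> V1 \<and> \<not> e \<subseteq> V2 \<longrightarrow> e \<in> neg G)))"

definition deg :: "'a sgraph \<Rightarrow> 'a \<Rightarrow> nat" where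
  "deg G v = card {e \<in> edges G. v \<in> e}"

definition clique :: "'a sgraph \<Rightarrow> 'a set \<Rightarrow> bool" where
  "clique G K \<longleftrightarrow> (\<forall>u\<in>K. \<forall>v\<in>K. u \<noteq> v \<longrightarrow> {u, v} \<in> edges G)"

definition independent :: "'a sgraph \<Rightarrow> 'a set \<Rightarrow> bool" where
  "independent G I \<longleftrightarrow> (\<forall>u\<in>I. \<forall>v\<in>I. {u, v} \<notin> edges G)"

definition dstar_split :: "nat \<Rightarrow> 'a sgraph \<Rightarrow> bool" where
  "dstar_split d G \<longleftrightarrow> (\<exists>K I. K \<union> I = verts G \<and> K \<inter> I = {} \<and> clique G K \<and> independent G I \<and>
     (\<forall>u\<in>K. \<exists>v\<in>I. {u, v} \<in> edges G) \<and> (\<forall>v\<in>I. deg G v \<le> d))"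


section \<open>Signed Max Cut ATLB\<close>

definition smc_instance :: "'a sgraph \<Rightarrow> nat \<Rightarrow> bool" where
  "smc_instance G k \<longleftrightarrow> signed_graph G \<and> connected_graph G \<and> 0 < k"

definition smc_yes :: "'a sgraph \<Rightarrow> nat \<Rightarrow> bool" where
  "smc_yes G k \<longleftrightarrow> smc_instance G k \<and> (\<exists>H. subgraph H G \<and> balanced H \<and>
     real (card (edges H)) \<ge>
       real (card (edges G)) / 2 + (real (card (verts G)) - 1) / 4 + real k / 4)"


section \<open>Polynomial time\<close>

text \<open>Structured programs over finitely many stacks of bits; this is a notational variant of
  deterministic multi-tape Turing machines (a tape is a pair of stacks). \<open>exec c s t s'\<close> says
  that \<open>c\<close>, started in \<open>s\<close>, halts in \<open>s'\<close> after \<open>t\<close> steps, where each push, pop and test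
  takes one step.\<close>

type_synonym stacks = "nat \<Rightarrow> bool list"

datatype test = Nonempty nat | TopOne nat

fun test_val :: "test \<Rightarrow> stacks \<Rightarrow> bool" where
  "test_val (Nonempty r) s = (s r \<noteq> [])"
| "test_val (TopOne r) s = (s r \<noteq> [] \<and> hd (s r))"

datatype prog =
    Skip
  | Push nat bool
  | Pop nat
  | Seq prog prog
  | Branch test prog prog
  | Loop test prog

inductive exec :: "prog \<Rightarrow> stacks \<Rightarrow> nat \<Rightarrow> stacks \<Rightarrow> bool" where
  exec_Skip: "exec Skip s 0 s"
| exec_Push: "exec (Push r b) s 1 (s(r := b # s r))"
| exec_Pop: "exec (Pop r) s 1 (s(r := tl (s r)))"
| exec_Seq: "exec c1 s t1 s' \<Longrightarrow> exec c2 s' t2 s'' \<Longrightarrow> exec (Seq c1 c2) s (t1 + t2) s''"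
| exec_BranchT: "test_val b s \<Longrightarrow> exec c1 s t s' \<Longrightarrow> exec (Branch b c1 c2) s (Suc t) s'"
| exec_BranchF: "\<not> test_val b s \<Longrightarrow> exec c2 s t s' \<Longrightarrow> exec (Branch b c1 c2) s (Suc t) s'"
| exec_LoopT: "test_val b s \<Longrightarrow> exec c s t1 s' \<Longrightarrow> exec (Loop b c) s' t2 s'' \<Longrightarrow>
    exec (Loop b c) s (Suc (t1 + t2)) s''"
| exec_LoopF: "\<not> test_val b s \<Longrightarrow> exec (Loop b c) s 1 s"


section \<open>Kernels\<close>

text \<open>A parameterized problem is given by its instances, its Yes-instances (a subset of the
  instances) and a binary encoding. Algorithms are only required to work on \<open>insts\<close>, so
  restricting a problem means restricting both sets.\<close>

record 'i param_problem =
  insts :: "('i \<times> nat) set"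
  yes_insts :: "('i \<times> nat) set"
  encode :: "'i \<Rightarrow> bool list"

text \<open>A kernelization algorithm may decide the instance outright (\<open>Answer\<close>) or return a
  new instance (\<open>Reduced\<close>).\<close>

datatype 'i outcome = Answer bool | Reduced 'i nat

text \<open>The instance is supplied on stack 0 and the parameter in unary on stack 1.\<close>

definition init_stacks :: "'i param_problem \<Rightarrow> 'i \<Rightarrow> nat \<Rightarrow> stacks" where
  "init_stacks P x k = (\<lambda>_. [])(0 := encode P x, 1 := replicate k True)"

text \<open>Stack 2 is empty at the end iff a new instance is returned, which is then found on
  stacks 0 and 1; otherwise stack 2 holds the answer.\<close>

fun outputs :: "'i param_problem \<Rightarrow> stacks \<Rightarrow> 'i outcome \<Rightarrow> bool" where
  "outputs P s (Answer b) \<longleftrightarrow> s 2 = [b]"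
| "outputs P s (Reduced x k) \<longleftrightarrow> s 0 = encode P x \<and> s 1 = replicate k True \<and> s 2 = []"

definition poly_time :: "'i param_problem \<Rightarrow> ('i \<Rightarrow> nat \<Rightarrow> 'i outcome) \<Rightarrow> bool" where
  "poly_time P A \<longleftrightarrow> (\<exists>(c :: prog) (p :: nat poly). \<forall>(x, k)\<in>insts P. \<exists>t s.
     exec c (init_stacks P x k) t s \<and> t \<le> poly p (length (encode P x) + k) \<and>
     outputs P s (A x k))"

text \<open>Kernelization whose output has size (measured by \<open>sz\<close>) at most \<open>f k\<close>, and whose new
  parameter does not exceed the old one.\<close>

definition kernelization ::
    "'i param_problem \<Rightarrow> ('i \<Rightarrow> nat) \<Rightarrow> (nat \<Rightarrow> nat) \<Rightarrow> ('i \<Rightarrow> nat \<Rightarrow> 'i outcome) \<Rightarrow> bool" where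
  "kernelization P sz f A \<longleftrightarrow> poly_time P A \<and>
     (\<forall>(x, k)\<in>insts P. case A x k of
         Answer b \<Rightarrow> b \<longleftrightarrow> (x, k) \<in> yes_insts P
       | Reduced x' k' \<Rightarrow> (x', k') \<in> insts P \<and>
           ((x', k') \<in> yes_insts P \<longleftrightarrow> (x, k) \<in> yes_insts P) \<and> sz x' \<le> f k \<and> k' \<le> k)"

text \<open>In the strict sense a kernelization always returns an instance.\<close>

definition admits_kernel :: "'i param_problem \<Rightarrow> ('i \<Rightarrow> nat) \<Rightarrow> (nat \<Rightarrow> nat) \<Rightarrow> bool" where
  "admits_kernel P sz f \<longleftrightarrow> (\<exists>A. kernelization P sz f A \<and>
     (\<forall>(x, k)\<in>insts P. \<exists>x' k'. A x k = Reduced x' k'))"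


section \<open>The problem restricted to split graphs, and its kernelization\<close>

text \<open>As algorithmic input, a graph with \<open>n\<close> vertices has vertex set \<open>{..<n}\<close>. It is encoded
  by \<open>n\<close> in unary followed by the adjacency matrix, with two bits per entry (positive edge,
  negative edge).\<close>

definition encode_sgraph :: "nat sgraph \<Rightarrow> bool list" where
  "encode_sgraph G = (let n = card (verts G) in
     replicate n True @ [False] @
     concat (map (\<lambda>i. concat (map (\<lambda>j. [{i, j} \<in> pos G, {i, j} \<in> neg G]) [0..<n])) [0..<n]))"

definition smc_split_problem :: "nat \<Rightarrow> nat sgraph param_problem" where
  "smc_split_problem d =
     \<lparr> insts = {(G, k). smc_instance G k \<and> dstar_split d G \<and> verts G = {..<card (verts G)}},
       yes_insts = {(G, k). smc_yes G k \<and> dstar_split d G \<and> verts G = {..<card (verts G)}},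
       encode = encode_sgraph \<rparr>"

definition smc_split_alg :: "nat \<Rightarrow> nat sgraph \<Rightarrow> nat \<Rightarrow> nat sgraph outcome" where
  "smc_split_alg d G k =
     (if card (verts G) \<ge> 4 * (d + 1) * k then Answer True else Reduced G k)"

end

theory Submission
  imports Defs "HOL-Library.FuncSet"
begin

text \<open>
  If the vertices are grouped into blocks such that some signing satisfies every edge inside a
  block, then flipping whole blocks suitably satisfies at least half of the remaining edges; so
  \<open>F\<close> edges inside blocks yield a balanced subgraph with at least \<open>m / 2 + F / 2\<close> edges.

  In a split graph take a matching of the clique \<open>K\<close> missing one vertex (two if \<open>card K\<close> is even),
  and let its edges and the unmatched vertices be blocks. A vertex \<open>v\<close> of \<open>I\<close> can be attached by a
  single edge to some block, unless its neighbourhood is a union of matching edges. For a random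
  matching this bad event has probability at most \<open>1 / 3\<close>, so \<open>2 F\<close> is at least about
  \<open>card K + 4 / 3 * card I\<close>. Every clique vertex has a neighbour in \<open>I\<close>, whence
  \<open>card K \<le> d * card I\<close>, and \<open>n \<ge> 4 (d + 1) k\<close> gives \<open>card I \<ge> 4 k\<close>, which makes
  \<open>2 F \<ge> n - 1 + k\<close>.

  The strict form of kernelization must output an instance, so it replaces the answer Yes by the
  fixed Yes-instance consisting of a single positive edge with parameter 1.
\<close>

section \<open>Signings that are constant on blocks\<close>

text \<open>The signed adjacency matrix; the value 0 on non-edges lets sums run over all ordered
  pairs of vertices.\<close>

definition edge_sign :: "'a sgraph \<Rightarrow> 'a \<Rightarrow> 'a \<Rightarrow> int" where
  "edge_sign G u v = (if {u, v} \<in> pos G then 1 else if {u, v} \<in> neg G then -1 else 0)"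

lemma edge_sign_commute: "edge_sign G u v = edge_sign G v u"
  by (simp add: edge_sign_def insert_commute)

lemma edge_sign_mult_self: "{u, v} \<in> edges G \<Longrightarrow> edge_sign G u v * edge_sign G u v = 1"
  by (auto simp: edge_sign_def edges_def)

lemma edge_sign_nonedge: "{u, v} \<notin> edges G \<Longrightarrow> edge_sign G u v = 0"
  by (auto simp: edge_sign_def edges_def)

section \<open>Counting edges through ordered pairs of vertices\<close>

lemma finite_edges: "signed_graph G \<Longrightarrow> finite (edges G)"
  unfolding signed_graph_def by (rule finite_subset[of _ "Pow (verts G)"]) auto

lemma card_ordered_pairs:
  assumes "finite E" "\<forall>e\<in>E. card e = 2"
  shows "card {(u, v). {u, v} \<in> E} = 2 * card E"
proof -
  have two: "finite {(u, v). {u, v} = e} \<and> card {(u, v). {u, v} = e} = 2" if e: "e \<in> E" for e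
  proof -
    obtain a b where "e = {a, b}" "a \<noteq> b"
      using bspec[OF assms(2) e] unfolding card_2_iff by blast
    moreover have "{(u, v). {u, v} = {a, b}} = {(a, b), (b, a)}"
      unfolding doubleton_eq_iff by auto
    ultimately show ?thesis by simp
  qed
  have "{(u, v). {u, v} \<in> E} = (\<Union>e\<in>E. {(u, v). {u, v} = e})" by auto
  then have "card {(u, v). {u, v} \<in> E} = (\<Sum>e\<in>E. card {(u, v). {u, v} = e})"
    using assms(1) two by (simp only:) (intro card_UN_disjoint, auto)
  then show ?thesis using two by simp
qed

lemma sum_ordered_pairs:
  assumes "finite V" "finite E" "\<forall>e\<in>E. e \<subseteq> V \<and> card e = 2"
  shows "(\<Sum>u\<in>V. \<Sum>v\<in>V. of_bool ({u, v} \<in> E)) = 2 * int (card E)"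
proof -
  have "(\<Sum>u\<in>V. \<Sum>v\<in>V. of_bool ({u, v} \<in> E)) = (\<Sum>p\<in>V \<times> V. of_bool ((\<lambda>(u, v). {u, v} \<in> E) p) :: int)"
    by (simp add: sum.cartesian_product case_prod_unfold)
  also have "\<dots> = int (card (V \<times> V \<inter> {(u, v). {u, v} \<in> E}))"
    using assms(1) by (simp only: sum_of_bool_eq finite_cartesian_product)
  also have "V \<times> V \<inter> {(u, v). {u, v} \<in> E} = {(u, v). {u, v} \<in> E}"
    using assms(3) by auto
  finally show ?thesis
    using card_ordered_pairs[of E] assms by simp
qed

text \<open>The sign classes of \<open>x\<close> are the two parts, and \<open>H\<close> keeps the
  edges whose term in the sum is 1. All other edges have term -1, and each edge occurs in both
  orders, so with \<open>h\<close> and \<open>m\<close> edges in \<open>H\<close> and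
  \<open>G\<close> the sum is \<open>2 * (h - (m - h))\<close>.\<close>

lemma balanced_subgraph_of_signing:
  fixes x :: "'a \<Rightarrow> int"
  assumes G: "signed_graph G" and x: "\<And>v. x v = 1 \<or> x v = -1"
  obtains H where "subgraph H G" "balanced H"
    "4 * int (card (edges H)) - 2 * int (card (edges G)) =
      (\<Sum>u\<in>verts G. \<Sum>v\<in>verts G. edge_sign G u v * x u * x v)"
proof -
  let ?V1 = "{v \<in> verts G. x v = 1}" and ?V2 = "{v \<in> verts G. x v \<noteq> 1}"
  define H where "H = \<lparr>verts = verts G,
     pos = {e \<in> pos G. e \<subseteq> ?V1 \<or> e \<subseteq> ?V2},
     neg = {e \<in> neg G. \<not> e \<subseteq> ?V1 \<and> \<not> e \<subseteq> ?V2}\<rparr>"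
  have V: "finite (verts G)" and E: "\<forall>e\<in>edges G. e \<subseteq> verts G \<and> card e = 2"
    using G by (auto simp: signed_graph_def)
  have sub: "edges H \<subseteq> edges G" by (auto simp: H_def edges_def)
  then have EH: "\<forall>e\<in>edges H. e \<subseteq> verts G \<and> card e = 2" using E by blast
  have H: "signed_graph H"
    using G sub unfolding signed_graph_def by (auto simp: H_def)
  have "subgraph H G"
    using H by (auto simp: subgraph_def H_def)
  moreover have "balanced H"
    unfolding balanced_def
    by (rule exI[of _ ?V1], rule exI[of _ ?V2]) (auto simp: H_def edges_def)
  moreover have "edge_sign G u v * x u * x v =
      2 * of_bool ({u, v} \<in> edges H) - of_bool ({u, v} \<in> edges G)"
    if "u \<in> verts G" "v \<in> verts G" for u v
  proof -
    have "{u, v} \<in> pos G \<Longrightarrow> {u, v} \<notin> neg G"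
      using G by (auto simp: signed_graph_def)
    then show ?thesis
      using x[of u] x[of v] that by (auto simp: edge_sign_def H_def edges_def)
  qed
  then have "(\<Sum>u\<in>verts G. \<Sum>v\<in>verts G. edge_sign G u v * x u * x v) =
     2 * (\<Sum>u\<in>verts G. \<Sum>v\<in>verts G. of_bool ({u, v} \<in> edges H))
      - (\<Sum>u\<in>verts G. \<Sum>v\<in>verts G. of_bool ({u, v} \<in> edges G))"
    by (simp add: sum_subtractf sum_distrib_left)
  then have "4 * int (card (edges H)) - 2 * int (card (edges G)) =
      (\<Sum>u\<in>verts G. \<Sum>v\<in>verts G. edge_sign G u v * x u * x v)"
    using sum_ordered_pairs[OF V finite_edges[OF G] E]
      sum_ordered_pairs[OF V finite_edges[OF H] EH] by simp
  ultimately show thesis by (rule that)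
qed

text \<open>Greedy choice: a new point \<open>a\<close> takes the sign of \<open>c\<close>, its
  weighted sum over the signs already fixed. By symmetry and the zero diagonal the form then grows
  by twice the absolute value of \<open>c\<close>.\<close>

lemma nonneg_signing:
  fixes w :: "'c \<Rightarrow> 'c \<Rightarrow> int"
  assumes "finite P" "\<And>p q. w p q = w q p" "\<And>p. w p p = 0"
  shows "\<exists>s. (\<forall>p. s p = 1 \<or> s p = -1) \<and> (\<Sum>p\<in>P. \<Sum>q\<in>P. w p q * s p * s q) \<ge> 0"
  using assms(1)
proof (induction P rule: finite_induct)
  case empty
  show ?case by (rule exI[of _ "\<lambda>_. 1"]) simp
next
  case (insert a P)
  then obtain s where s: "\<And>p. s p = 1 \<or> s p = -1"
    "(\<Sum>p\<in>P. \<Sum>q\<in>P. w p q * s p * s q) \<ge> 0" by blast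
  define c where "c = (\<Sum>q\<in>P. w a q * s q)"
  define s' where "s' = s(a := if c \<ge> 0 then 1 else -1)"
  have on_P: "s' p = s p" if "p \<in> P" for p
    using that insert.hyps by (auto simp: s'_def)
  have c: "(\<Sum>q\<in>P. w a q * s' a * s' q) = s' a * c"
    by (simp add: c_def sum_distrib_left on_P mult_ac cong: sum.cong)
  have c': "(\<Sum>p\<in>P. w p a * s' p * s' a) = s' a * c"
    by (simp add: c_def sum_distrib_left on_P mult_ac assms(2)[of _ a] cong: sum.cong)
  have "(\<Sum>p\<in>insert a P. \<Sum>q\<in>insert a P. w p q * s' p * s' q) =
     2 * (s' a * c) + (\<Sum>p\<in>P. \<Sum>q\<in>P. w p q * s' p * s' q)"
    using insert.hyps by (simp add: sum.distrib assms(3) c c')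
  also have "(\<Sum>p\<in>P. \<Sum>q\<in>P. w p q * s' p * s' q) = (\<Sum>p\<in>P. \<Sum>q\<in>P. w p q * s p * s q)"
    by (simp add: on_P cong: sum.cong)
  finally have "(\<Sum>p\<in>insert a P. \<Sum>q\<in>insert a P. w p q * s' p * s' q) \<ge> 0"
    using s(2) by (simp add: s'_def)
  moreover have "\<forall>p. s' p = 1 \<or> s' p = -1" using s(1) by (simp add: s'_def)
  ultimately show ?case by blast
qed

text \<open>Contracting each block to a point reduces this to \<open>nonneg_signing\<close>, with
  \<open>w p q\<close> the total weight between two different blocks.\<close>

lemma nonneg_block_signing:
  fixes W :: "'a \<Rightarrow> 'a \<Rightarrow> int" and b :: "'a \<Rightarrow> 'c"
  assumes V: "finite V" and sym: "\<And>u v. W u v = W v u"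
  shows "\<exists>s. (\<forall>p. s p = 1 \<or> s p = -1) \<and>
    (\<Sum>u\<in>V. \<Sum>v\<in>V. of_bool (b u \<noteq> b v) * W u v * s (b u) * s (b v)) \<ge> 0"
proof -
  define w where "w p q = of_bool (p \<noteq> q) *
    (\<Sum>u\<in>{u \<in> V. b u = p}. \<Sum>v\<in>{v \<in> V. b v = q}. W u v)" for p q
  have "w p q = w q p" for p q
  proof -
    have "(\<Sum>u\<in>{u \<in> V. b u = p}. \<Sum>v\<in>{v \<in> V. b v = q}. W u v) =
      (\<Sum>v\<in>{v \<in> V. b v = q}. \<Sum>u\<in>{u \<in> V. b u = p}. W v u)"
      by (subst sum.swap) (simp add: sym)
    then show ?thesis by (auto simp: w_def)
  qed
  moreover have "w p p = 0" for p by (simp add: w_def)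
  ultimately obtain s where s: "\<forall>p. s p = 1 \<or> s p = -1"
    "(\<Sum>p\<in>b ` V. \<Sum>q\<in>b ` V. w p q * s p * s q) \<ge> 0"
    using nonneg_signing[of "b ` V" w] V by auto
  have gen: "(\<Sum>u\<in>V. h u) = (\<Sum>p\<in>b ` V. \<Sum>u\<in>{u \<in> V. b u = p}. h u)" for h :: "'a \<Rightarrow> int"
    by (rule sum.image_gen[OF V])
  have "(\<Sum>u\<in>V. \<Sum>v\<in>V. of_bool (b u \<noteq> b v) * W u v * s (b u) * s (b v)) =
    (\<Sum>p\<in>b ` V. \<Sum>u\<in>{u \<in> V. b u = p}. \<Sum>q\<in>b ` V. \<Sum>v\<in>{v \<in> V. b v = q}.
       of_bool (b u \<noteq> b v) * W u v * s (b u) * s (b v))"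
    by (subst gen) (intro sum.cong[OF refl] gen)
  also have "\<dots> = (\<Sum>p\<in>b ` V. \<Sum>u\<in>{u \<in> V. b u = p}. \<Sum>q\<in>b ` V. \<Sum>v\<in>{v \<in> V. b v = q}.
       of_bool (p \<noteq> q) * W u v * s p * s q)"
    by (intro sum.cong refl) auto
  also have "\<dots> = (\<Sum>p\<in>b ` V. \<Sum>q\<in>b ` V. \<Sum>u\<in>{u \<in> V. b u = p}. \<Sum>v\<in>{v \<in> V. b v = q}.
       of_bool (p \<noteq> q) * W u v * s p * s q)"
    by (intro sum.cong refl sum.swap)
  also have "\<dots> = (\<Sum>p\<in>b ` V. \<Sum>q\<in>b ` V. w p q * s p * s q)"
    by (simp add: w_def sum_distrib_left sum_distrib_right)
  finally show ?thesis using s by (intro exI[of _ s] conjI) simp_all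
qed

text \<open>A sign per block is squared on inner edges, which therefore stay satisfied, and it can
  be chosen so that the edges between blocks contribute a nonnegative total. The last
  \<open>card\<close> counts ordered pairs, so each inner edge twice.\<close>

lemma balanced_subgraph_of_blocks:
  fixes x :: "'a \<Rightarrow> int" and b :: "'a \<Rightarrow> 'c"
  assumes G: "signed_graph G" and x: "\<And>v. x v = 1 \<or> x v = -1"
    and inner: "\<And>u v. {u, v} \<in> edges G \<Longrightarrow> b u = b v \<Longrightarrow> edge_sign G u v * x u * x v = 1"
  obtains H where "subgraph H G" "balanced H"
    "4 * card (edges H) \<ge> 2 * card (edges G) + card {(u, v). {u, v} \<in> edges G \<and> b u = b v}"
proof -
  let ?V = "verts G"
  let ?F = "{(u, v). {u, v} \<in> edges G \<and> b u = b v}"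
  have V: "finite ?V" and E: "\<forall>e\<in>edges G. e \<subseteq> ?V"
    using G by (auto simp: signed_graph_def)
  obtain s where s: "\<And>p. s p = 1 \<or> s p = -1"
    "(\<Sum>u\<in>?V. \<Sum>v\<in>?V. of_bool (b u \<noteq> b v) * (edge_sign G u v * x u * x v) * s (b u) * s (b v)) \<ge> 0"
    using nonneg_block_signing[OF V, of "\<lambda>u v. edge_sign G u v * x u * x v" b]
    by (auto simp: edge_sign_commute mult_ac)
  define y where "y v = x v * s (b v)" for v
  have y: "y v = 1 \<or> y v = -1" for v
    using x[of v] s(1)[of "b v"] by (auto simp: y_def)
  obtain H where H: "subgraph H G" "balanced H"
    "4 * int (card (edges H)) - 2 * int (card (edges G)) =
      (\<Sum>u\<in>?V. \<Sum>v\<in>?V. edge_sign G u v * y u * y v)"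
    using balanced_subgraph_of_signing[OF G, of y] y by blast
  have split: "edge_sign G u v * y u * y v = of_bool ({u, v} \<in> edges G \<and> b u = b v) +
      of_bool (b u \<noteq> b v) * (edge_sign G u v * x u * x v) * s (b u) * s (b v)" for u v
  proof (cases "{u, v} \<in> edges G \<and> b u = b v")
    case True
    then have "edge_sign G u v * y u * y v = (edge_sign G u v * x u * x v) * (s (b v) * s (b v))"
      by (simp add: y_def mult_ac)
    then show ?thesis using True inner[of u v] s(1)[of "b v"] by auto
  next
    case False
    then show ?thesis by (auto simp: y_def edge_sign_nonedge mult_ac)
  qed
  have "int (card ?F) = (\<Sum>p\<in>?V \<times> ?V. of_bool (p \<in> ?F))"
  proof -
    have "?V \<times> ?V \<inter> ?F = ?F" using E by auto
    then show ?thesis using V by (simp add: case_prod_unfold)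
  qed
  also have "\<dots> = (\<Sum>u\<in>?V. \<Sum>v\<in>?V. of_bool ({u, v} \<in> edges G \<and> b u = b v))"
    by (simp add: sum.cartesian_product case_prod_unfold)
  finally have "4 * int (card (edges H)) - 2 * int (card (edges G)) \<ge> int (card ?F)"
    using H(3) s(2) by (simp only: split sum.distrib)
  then show thesis using that[OF H(1,2)] by linarith
qed

section \<open>Random matchings\<close>

text \<open>Matchings of \<open>K\<close> missing exactly one vertex, as involutions.\<close>

definition pair_up :: "'a set \<Rightarrow> ('a \<Rightarrow> 'a) set" where
  "pair_up K = {m. (\<forall>u. m (m u) = u) \<and> (\<forall>u. u \<notin> K \<longrightarrow> m u = u) \<and> (\<exists>!u. u \<in> K \<and> m u = u)}"

lemma pair_up_involution: "m \<in> pair_up K \<Longrightarrow> m (m u) = u"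
  by (simp add: pair_up_def)

lemma pair_up_outside: "m \<in> pair_up K \<Longrightarrow> u \<notin> K \<Longrightarrow> m u = u"
  by (simp add: pair_up_def)

lemma pair_up_fixpoint: "m \<in> pair_up K \<Longrightarrow> \<exists>!u. u \<in> K \<and> m u = u"
  by (simp add: pair_up_def)

lemma pair_up_permutes: "m \<in> pair_up K \<Longrightarrow> u \<in> K \<Longrightarrow> m u \<in> K"
  by (metis pair_up_involution pair_up_outside)

lemma finite_pair_up:
  assumes "finite K"
  shows "finite (pair_up K)"
proof -
  have "pair_up K \<subseteq> (\<lambda>f u. if u \<in> K then f u else u) ` (K \<rightarrow>\<^sub>E K)"
  proof
    fix m assume m: "m \<in> pair_up K"
    then have "restrict m K \<in> K \<rightarrow>\<^sub>E K"
      using pair_up_permutes by auto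
    moreover have "m = (\<lambda>u. if u \<in> K then restrict m K u else u)"
      by (rule ext) (simp add: pair_up_outside[OF m])
    ultimately show "m \<in> (\<lambda>f u. if u \<in> K then f u else u) ` (K \<rightarrow>\<^sub>E K)" by blast
  qed
  then show ?thesis
    using assms finite_PiE[of K "\<lambda>_. K"] by (meson finite_imageI finite_subset)
qed

text \<open>Match two vertices with each other and pair up the rest, whose size is again odd; for a
  single vertex the identity serves.\<close>

lemma pair_up_nonempty:
  assumes "finite K" "odd (card K)"
  shows "pair_up K \<noteq> {}"
  using assms
proof (induction "card K" arbitrary: K rule: less_induct)
  case less
  then have "card K \<noteq> 0" by (metis even_zero)
  then obtain a where a: "a \<in> K" by fastforce
  show ?case
  proof (cases "K = {a}")
    case True
    then have "id \<in> pair_up K" by (auto simp: pair_up_def)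
    then show ?thesis by blast
  next
    case False
    then obtain b where b: "b \<in> K" "b \<noteq> a" using a by blast
    let ?K = "K - {a, b}"
    have c: "card ?K = card K - 2" "card K \<ge> 2"
      using a b less.prems card_mono[of K "{a, b}"] by (auto simp: card_Diff_subset)
    then obtain m where m: "m \<in> pair_up ?K"
      using less.hyps[of ?K] less.prems by fastforce
    let ?m = "m(a := b, b := a)"
    have mab: "m a = a" "m b = b" using pair_up_outside[OF m] by auto
    have inv: "m (m u) = u" for u by (rule pair_up_involution[OF m])
    have nab: "m u \<noteq> a" "m u \<noteq> b" if "u \<noteq> a" "u \<noteq> b" for u
      using mab inv that by metis+
    obtain y where y: "y \<in> ?K" "m y = y" "\<And>u. u \<in> ?K \<Longrightarrow> m u = u \<Longrightarrow> u = y"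
      using pair_up_fixpoint[OF m] by blast
    have "\<forall>u. ?m (?m u) = u" using inv nab b by auto
    moreover have "\<forall>u. u \<notin> K \<longrightarrow> ?m u = u" using pair_up_outside[OF m] a b by auto
    moreover have "\<exists>!u. u \<in> K \<and> ?m u = u"
    proof (rule ex1I[of _ y])
      show "y \<in> K \<and> ?m y = y" using y(1,2) by simp
    next
      fix u assume "u \<in> K \<and> ?m u = u"
      then show "u = y" using y(3)[of u] b(2) by (cases "u = a"; cases "u = b") auto
    qed
    ultimately have "?m \<in> pair_up K" unfolding pair_up_def by blast
    then show ?thesis by blast
  qed
qed

text \<open>Here \<open>N\<close> is a union of matching edges, so a vertex with neighbourhood
  \<open>N\<close> has zero or two neighbours in every block. Since \<open>m\<close> is the identity
  off \<open>K\<close>, such an \<open>N\<close> lies inside \<open>K\<close>.\<close>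

definition bad_pairings :: "'a set \<Rightarrow> 'a set \<Rightarrow> ('a \<Rightarrow> 'a) set" where
  "bad_pairings K N = {m \<in> pair_up K. \<forall>u\<in>N. m u \<in> N \<and> m u \<noteq> u}"

text \<open>The unmatched \<open>y\<close> replaces \<open>a\<close> as the partner of
  \<open>b\<close>, which frees \<open>a\<close>. It is applied below with either end of a matching
  edge in the role of \<open>a\<close>.\<close>

lemma pair_up_exchange:
  assumes m: "m \<in> pair_up K" "m a = b" "m y = y" and K: "a \<in> K" "y \<in> K"
    and ne: "a \<noteq> b" "y \<noteq> a" "y \<noteq> b"
  shows "m(a := a, b := y, y := b) \<in> pair_up K"
proof -
  let ?m = "m(a := a, b := y, y := b)"
  have b: "m b = a" "b \<in> K"
    using pair_up_involution[OF m(1), of a] pair_up_permutes[OF m(1) K(1)] m(2) by auto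
  have other: "m u \<noteq> a" "m u \<noteq> b" "m u \<noteq> y" if "u \<noteq> a" "u \<noteq> b" "u \<noteq> y" for u
    using pair_up_involution[OF m(1), of u] that m b by metis+
  have y_unique: "u = y" if "u \<in> K" "m u = u" for u
    using pair_up_fixpoint[OF m(1)] that m(3) K(2) by blast
  have "?m (?m u) = u" for u
  proof -
    consider "u = a" | "u = b" | "u = y" | "u \<noteq> a" "u \<noteq> b" "u \<noteq> y" by blast
    then show ?thesis using ne other[of u] pair_up_involution[OF m(1), of u] by cases simp_all
  qed
  moreover have "?m u = u" if "u \<notin> K" for u
    using that K b pair_up_outside[OF m(1), of u] by auto
  moreover have "\<exists>!u. u \<in> K \<and> ?m u = u"
  proof (rule ex1I[of _ a])
    show "a \<in> K \<and> ?m a = a" using K ne by simp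
    fix u assume u: "u \<in> K \<and> ?m u = u"
    show "u = a"
    proof (rule ccontr)
      assume "u \<noteq> a"
      moreover have "u \<noteq> b" "u \<noteq> y" using u ne by auto
      ultimately show False using u y_unique[of u] by simp
    qed
  qed
  ultimately show ?thesis unfolding pair_up_def by blast
qed

text \<open>Fix \<open>a \<in> N\<close>. A bad matching has its unmatched vertex \<open>y\<close> outside \<open>N\<close>; exchanging \<open>y\<close> with \<open>a\<close>, or
  with the partner of \<open>a\<close>, gives two good matchings. They determine the bad one, since in them the
  partner of \<open>a\<close> is the only vertex of \<open>N\<close> matched outside \<open>N\<close>, respectively unmatched.\<close>

lemma card_bad_pairings:
  assumes K: "finite K" and N: "N \<noteq> {}"
  shows "3 * card (bad_pairings K N) \<le> card (pair_up K)"
proof -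
  obtain a where a: "a \<in> N" using N by blast
  define y where "y m = (THE u. u \<in> K \<and> m u = u)" for m :: "'a \<Rightarrow> 'a"
  define f where "f m = m(a := a, m a := y m, y m := m a)" for m
  define g where "g m = m(m a := m a, a := y m, y m := a)" for m
  let ?B = "bad_pairings K N"
  have inv: "m (m u) = u" and out: "u \<notin> K \<Longrightarrow> m u = u"
    and bad: "u \<in> N \<Longrightarrow> m u \<in> N \<and> m u \<noteq> u" if "m \<in> ?B" for m u
    using that pair_up_involution[of m K] pair_up_outside[of m K]
    by (auto simp: bad_pairings_def)
  have y: "y m \<in> K \<and> m (y m) = y m" if "m \<in> ?B" for m
    unfolding y_def by (rule theI'[OF pair_up_fixpoint]) (use that in \<open>simp add: bad_pairings_def\<close>)
  have NK: "u \<in> K" if "m \<in> ?B" "u \<in> N" for m u using that out bad by blast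
  have yN: "y m \<notin> N" if "m \<in> ?B" for m using that y bad by blast
  have maN: "m a \<in> N" "m a \<noteq> a" if "m \<in> ?B" for m using that bad a by auto
  have ne: "y m \<noteq> a" "y m \<noteq> m a" if "m \<in> ?B" for m using yN[OF that] maN[OF that] a by auto
  have f_in: "f m \<in> pair_up K - ?B" if m: "m \<in> ?B" for m
  proof -
    have "f m \<in> pair_up K"
      unfolding f_def using m y[OF m] maN[OF m] ne[OF m] NK[OF m a]
      by (intro pair_up_exchange) (auto simp: bad_pairings_def)
    moreover have "f m a = a" using ne[OF m] maN[OF m] by (simp add: f_def)
    ultimately show ?thesis using bad a by blast
  qed
  have g_in: "g m \<in> pair_up K - ?B" if m: "m \<in> ?B" for m
  proof -
    have "g m \<in> pair_up K"
      unfolding g_def using m y[OF m] maN[OF m] ne[OF m] NK[OF m maN(1)[OF m]] inv[OF m]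
      by (intro pair_up_exchange) (auto simp: bad_pairings_def)
    moreover have "g m (m a) = m a" using ne[OF m] maN[OF m] by (simp add: g_def)
    ultimately show ?thesis using bad maN(1)[OF m] by blast
  qed
  have f_inj: "inj_on f ?B"
  proof (rule inj_on_inverseI)
    fix m assume m: "m \<in> ?B"
    note ne = ne[OF m] maN[OF m]
    have "(THE b. b \<in> N \<and> f m b \<notin> N) = m a"
    proof (rule the_equality)
      show "m a \<in> N \<and> f m (m a) \<notin> N" using ne yN[OF m] by (simp add: f_def)
      fix b assume b: "b \<in> N \<and> f m b \<notin> N"
      then have "b \<noteq> y m" "b \<noteq> a" using yN[OF m] ne by (auto simp: f_def)
      then have "b \<noteq> m a \<Longrightarrow> f m b = m b" by (simp add: f_def)
      then show "b = m a" using b bad[OF m, of b] by metis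
    qed
    moreover have "f m (m a) = y m" using ne by (simp add: f_def)
    \<comment> \<open>Here \<open>b\<close> is the recovered partner of \<open>a\<close>, and
      \<open>h b\<close> is the vertex that was unmatched in \<open>m\<close>; the updates rematch
      \<open>a\<close> with \<open>b\<close> and free \<open>h b\<close>.\<close>
    ultimately show "(\<lambda>h. let b = (THE b. b \<in> N \<and> h b \<notin> N) in h(a := b, b := a, h b := h b)) (f m) = m"
      using ne y[OF m] inv[OF m] by (simp add: f_def fun_eq_iff)
  qed
  have g_inj: "inj_on g ?B"
  proof (rule inj_on_inverseI)
    fix m assume m: "m \<in> ?B"
    note ne = ne[OF m] maN[OF m]
    have "(THE b. b \<in> N \<and> g m b = b) = m a"
    proof (rule the_equality)
      show "m a \<in> N \<and> g m (m a) = m a" using ne by (simp add: g_def)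
      fix b assume b: "b \<in> N \<and> g m b = b"
      then have "b \<noteq> y m" "b \<noteq> a" using yN[OF m] ne by (auto simp: g_def)
      then have "b \<noteq> m a \<Longrightarrow> g m b = m b" by (simp add: g_def)
      then show "b = m a" using b bad[OF m, of b] by metis
    qed
    moreover have "g m a = y m" using ne by (simp add: g_def)
    ultimately show "(\<lambda>h. let b = (THE b. b \<in> N \<and> h b = b) in h(a := b, b := a, h a := h a)) (g m) = m"
      using ne y[OF m] inv[OF m] by (simp add: g_def fun_eq_iff)
  qed
  \<comment> \<open>The two exchanges differ at \<open>a\<close>: the first leaves it unmatched, the
    second matches it with the former unmatched vertex.\<close>
  have "f m \<noteq> g m'" if "m \<in> ?B" "m' \<in> ?B" for m m'
  proof -
    have "f m a = a" "g m' a \<noteq> a"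
      using ne[OF that(1)] maN[OF that(1)] ne[OF that(2)] by (simp_all add: f_def g_def)
    then show ?thesis by metis
  qed
  then have disj: "f ` ?B \<inter> g ` ?B = {}" by blast
  have fin: "finite (pair_up K)" using finite_pair_up[OF K] .
  have B: "?B \<subseteq> pair_up K" by (auto simp: bad_pairings_def)
  have finB: "finite ?B" using fin B by (rule rev_finite_subset)
  \<comment> \<open>\<open>?B\<close> and its images under \<open>f\<close> and \<open>g\<close> are
    three disjoint subsets of \<open>pair_up K\<close> of equal size.\<close>
  have "card ?B + card ?B + card ?B = card ?B + card (f ` ?B \<union> g ` ?B)"
    using finB disj by (simp add: card_Un_disjoint card_image f_inj g_inj)
  also have "\<dots> = card (?B \<union> (f ` ?B \<union> g ` ?B))"
    using finB f_in g_in by (subst card_Un_disjoint[of ?B]) auto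
  also have "\<dots> \<le> card (pair_up K)"
    using fin B f_in g_in by (intro card_mono) auto
  finally show ?thesis by simp
qed

text \<open>Averaging: by \<open>card_bad_pairings\<close>, double counting the pairs of
  \<open>m\<close> and \<open>v\<close> with \<open>m\<close> bad for \<open>v\<close> bounds the
  mean number of such \<open>v\<close> by a third of \<open>card J\<close>.\<close>

lemma few_bad_pairings:
  assumes K: "finite K" "odd (card K)" and J: "finite J" and N: "\<forall>v\<in>J. N v \<noteq> {}"
  obtains m where "m \<in> pair_up K" "3 * card {v \<in> J. m \<in> bad_pairings K (N v)} \<le> card J"
proof -
  have fin: "finite (pair_up K)" using finite_pair_up[OF K(1)] .
  have "\<exists>m\<in>pair_up K. 3 * card {v \<in> J. m \<in> bad_pairings K (N v)} \<le> card J"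
  proof (rule ccontr)
    assume "\<not> ?thesis"
    then have more: "\<forall>m\<in>pair_up K. card J < 3 * card {v \<in> J. m \<in> bad_pairings K (N v)}"
      by auto
    have "card (pair_up K) * card J = (\<Sum>m\<in>pair_up K. card J)" by simp
    also have "\<dots> < (\<Sum>m\<in>pair_up K. 3 * card {v \<in> J. m \<in> bad_pairings K (N v)})"
      using more fin pair_up_nonempty[OF K] by (intro sum_strict_mono) auto
    also have "\<dots> = 3 * (\<Sum>v\<in>J. card {m \<in> pair_up K. m \<in> bad_pairings K (N v)})"
      using sum.swap_restrict[OF fin J, of "\<lambda>_ _. 1::nat" "\<lambda>m v. m \<in> bad_pairings K (N v)"]
      by (simp add: sum_distrib_left[symmetric])
    also have "\<dots> = (\<Sum>v\<in>J. 3 * card (bad_pairings K (N v)))"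
      by (simp add: sum_distrib_left bad_pairings_def conj_assoc[symmetric])
    also have "\<dots> \<le> (\<Sum>v\<in>J. card (pair_up K))"
      using card_bad_pairings[OF K(1)] N by (intro sum_mono) auto
    finally show False by (simp add: mult.commute)
  qed
  then show thesis using that by blast
qed

text \<open>The subset \<open>K'\<close> allows one vertex to be left out when \<open>card K\<close>
  is even. Vertices outside \<open>K'\<close> are fixed by \<open>m\<close>, so only neighbourhoods
  inside \<open>K'\<close> can be bad, which sharpens the last bound.\<close>

lemma good_matching:
  assumes K: "finite K" "K' \<subseteq> K" "odd (card K')" and I: "finite I"
    and N: "\<forall>v\<in>I. N v \<noteq> {} \<and> N v \<subseteq> K"
  obtains m J where "\<forall>u\<in>K. m u \<in> K \<and> m (m u) = u" "J \<subseteq> I"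
    "\<forall>v\<in>J. \<exists>u\<in>N v. m u = u \<or> m u \<notin> N v"
    "card {u \<in> K. m u \<noteq> u} + 1 = card K'"
    "3 * card (I - J) \<le> card {v \<in> I. N v \<subseteq> K'}"
proof -
  let ?I = "{v \<in> I. N v \<subseteq> K'}"
  have K': "finite K'" using K by (simp add: finite_subset)
  obtain m where m: "m \<in> pair_up K'"
    and few: "3 * card {v \<in> ?I. m \<in> bad_pairings K' (N v)} \<le> card ?I"
    using few_bad_pairings[OF K' K(3), of ?I N] I N by auto
  define J where "J = {v \<in> I. m \<notin> bad_pairings K' (N v)}"
  have "\<forall>u\<in>K. m u \<in> K \<and> m (m u) = u"
    using pair_up_involution[OF m] pair_up_outside[OF m] pair_up_permutes[OF m] K(2)
    by (metis subsetD)
  moreover have "J \<subseteq> I" by (auto simp: J_def)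
  moreover have "\<forall>v\<in>J. \<exists>u\<in>N v. m u = u \<or> m u \<notin> N v"
    using m by (auto simp: J_def bad_pairings_def)
  moreover have "card {u \<in> K. m u \<noteq> u} + 1 = card K'"
  proof -
    obtain y where y: "y \<in> K'" "m y = y" "\<And>u. u \<in> K' \<Longrightarrow> m u = u \<Longrightarrow> u = y"
      using pair_up_fixpoint[OF m] by blast
    have "u \<in> K \<and> m u \<noteq> u \<longleftrightarrow> u \<in> K' - {y}" for u
      using y pair_up_outside[OF m, of u] K(2) by blast
    then have "{u \<in> K. m u \<noteq> u} = K' - {y}" by blast
    then show ?thesis using card.remove[OF K' y(1)] by simp
  qed
  moreover have "I - J = {v \<in> ?I. m \<in> bad_pairings K' (N v)}"
  proof -
    have "u \<in> K'" if "m \<in> bad_pairings K' (N v)" "u \<in> N v" for u v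
      using that pair_up_outside[OF m, of u] by (auto simp: bad_pairings_def)
    then show ?thesis by (auto simp: J_def)
  qed
  ultimately show thesis using that few by simp
qed

section \<open>Large split graphs\<close>

text \<open>A block is a matching edge or an unmatched clique vertex, with pendant vertices of
  \<open>J\<close> attached by one edge each; the remaining vertices are singletons. The edges
  inside a block form a tree, so some signing satisfies all of them.\<close>

lemma balanced_subgraph_of_matching:
  assumes G: "signed_graph G" and V: "K \<union> I = verts G" "K \<inter> I = {}"
    and clique: "clique G K" and indep: "independent G I"
    and m: "\<forall>u\<in>K. m u \<in> K \<and> m (m u) = u"
    and J: "J \<subseteq> I" "\<forall>v\<in>J. \<exists>u. {u, v} \<in> edges G \<and> (m u = u \<or> {m u, v} \<notin> edges G)"
  obtains H where "subgraph H G" "balanced H"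
    "4 * card (edges H) \<ge> 2 * card (edges G) + card {u \<in> K. m u \<noteq> u} + 2 * card J"
proof -
  let ?E = "edges G"
  have fin: "finite K" "finite J"
    using G V J(1) unfolding signed_graph_def by (metis finite_Un finite_subset)+
  have E: "u \<noteq> v \<and> u \<in> verts G \<and> v \<in> verts G" if "{u, v} \<in> ?E" for u v
    using G that unfolding signed_graph_def by fastforce
  have II: "{u, v} \<notin> ?E" if "u \<in> I" "v \<in> I" for u v
    using indep that by (auto simp: independent_def)
  have "\<forall>v\<in>J. \<exists>u. u \<in> K \<and> {u, v} \<in> ?E \<and> (m u = u \<or> {m u, v} \<notin> ?E)"
    using J V(1) E II by blast
  then obtain c where c: "\<And>v. v \<in> J \<Longrightarrow> c v \<in> K \<and> {c v, v} \<in> ?E \<and> (m (c v) = c v \<or> {m (c v), v} \<notin> ?E)"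
    by metis
  have JK: "v \<notin> K" if "v \<in> J" for v using that J(1) V(2) by blast
  \<comment> \<open>Choosing from the set \<open>{u, m u}\<close> gives both ends of a matching edge
    the same representative, whose sign is set to 1.\<close>
  define r where "r u = (SOME w. w \<in> {u, m u})" for u
  define y where "y u = (if u = r u then 1 else edge_sign G u (r u))" for u
  \<comment> \<open>A pendant vertex gets the sign that satisfies its edge to \<open>c v\<close>.
    Vertices outside \<open>K\<close> and \<open>J\<close> are alone in their block, so the default
    1 is harmless.\<close>
  define x where "x v = (if v \<in> K then y v else if v \<in> J then edge_sign G v (c v) * y (c v) else 1)" for v
  define b where "b v = (if v \<in> K then {v, m v} else if v \<in> J then {c v, m (c v)} else {v})" for v
  have sign: "edge_sign G u v = 1 \<or> edge_sign G u v = -1" if "{u, v} \<in> ?E" for u v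
    using that by (auto simp: edge_sign_def edges_def)
  have r: "r u = u \<or> r u = m u" for u
    unfolding r_def using someI[of "\<lambda>w. w \<in> {u, m u}" u] by auto
  have rm: "r (m u) = r u" if "u \<in> K" for u
    using m that by (simp add: r_def insert_commute)
  have um: "{u, m u} \<in> ?E" if "u \<in> K" "m u \<noteq> u" for u
    using clique m that unfolding clique_def by metis
  have y: "y u = 1 \<or> y u = -1" if "u \<in> K" for u
    using r[of u] sign[OF um[OF that]] by (auto simp: y_def)
  have x: "x v = 1 \<or> x v = -1" for v
  proof -
    have "edge_sign G v (c v) = 1 \<or> edge_sign G v (c v) = -1" if "v \<in> J"
      using c[OF that] by (intro sign) (simp add: insert_commute)
    then show ?thesis using y[of v] y[of "c v"] c[of v] by (auto simp: x_def)
  qed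
  have pair: "edge_sign G u (m u) * y u * y (m u) = 1" if u: "u \<in> K" "m u \<noteq> u" for u
  proof -
    note s = edge_sign_mult_self[OF um[OF u]]
    have "edge_sign G (m u) u = edge_sign G u (m u)" by (rule edge_sign_commute)
    moreover have "y u = 1 \<and> y (m u) = edge_sign G (m u) u \<or> y u = edge_sign G u (m u) \<and> y (m u) = 1"
      using r[of u] u(2) unfolding y_def rm[OF u(1)] by metis
    ultimately show ?thesis using s by auto
  qed
  have KK: "w = m u" if "u \<in> K" "w \<in> K" "u \<noteq> w" "b u = b w" for u w
    using that by (auto simp: b_def doubleton_eq_iff)
  \<comment> \<open>The choice of \<open>c\<close> enters here: the partner of \<open>c v\<close> is
    not a neighbour of \<open>v\<close>, so the edge to \<open>c v\<close> is the only one from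
    \<open>v\<close> inside its block.\<close>
  have KI: "v \<in> J \<and> u = c v" if "u \<in> K" "v \<notin> K" "{u, v} \<in> ?E" "b u = b v" for u v
  proof -
    have "v \<in> J" using that by (auto simp: b_def split: if_splits)
    moreover from this have "u = c v \<or> u = m (c v)" using that by (auto simp: b_def)
    ultimately show ?thesis using c[of v] that(3) by auto
  qed
  have inner: "edge_sign G u v * x u * x v = 1" if e: "{u, v} \<in> ?E" "b u = b v" for u v
  proof -
    have *: "edge_sign G u v * x u * x v = 1"
      if "u \<in> K" "v \<notin> K" "{u, v} \<in> ?E" "b u = b v" for u v
    proof -
      have v: "v \<in> J" "u = c v" using KI[OF that] by auto
      have "edge_sign G u v * x u * x v = (edge_sign G u v * edge_sign G v u) * (y u * y u)"
        using v that(1,2) by (simp add: x_def mult_ac)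
      also have "\<dots> = 1"
        using edge_sign_mult_self[OF that(3)] edge_sign_commute[of G v u] y[OF that(1)] by auto
      finally show ?thesis .
    qed
    consider "u \<in> K" "v \<in> K" | "u \<in> K" "v \<notin> K" | "u \<notin> K" "v \<in> K"
      using E[OF e(1)] II[of u v] e(1) V(1) by blast
    then show ?thesis
    proof cases
      case 1
      then have "v = m u" "m u \<noteq> u" using KK[OF 1 _ e(2)] E[OF e(1)] by auto
      then show ?thesis using pair 1 by (simp add: x_def)
    next
      case 2
      then show ?thesis using * e by blast
    next
      case 3
      have "{v, u} \<in> ?E" using e(1) by (simp add: insert_commute)
      then show ?thesis
        using *[of v u] 3 e(2) edge_sign_commute[of G u v] by (simp add: mult_ac)
    qed
  qed
  obtain H where H: "subgraph H G" "balanced H"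
    "4 * card (edges H) \<ge> 2 * card ?E + card {(u, v). {u, v} \<in> ?E \<and> b u = b v}"
    using balanced_subgraph_of_blocks[of G x b, OF G x inner] by blast
  let ?F = "{(u, v). {u, v} \<in> ?E \<and> b u = b v}"
  \<comment> \<open>As \<open>u\<close> ranges over both ends, \<open>?A\<close> already contains
    each matching edge in both orders; \<open>?B\<close> and \<open>?C\<close> are the two orders of
    the pendant edges.\<close>
  let ?A = "(\<lambda>u. (u, m u)) ` {u \<in> K. m u \<noteq> u}"
  let ?B = "(\<lambda>v. (c v, v)) ` J" and ?C = "(\<lambda>v. (v, c v)) ` J"
  have cb: "b (c v) = b v" if "v \<in> J" for v
    using c[OF that] JK[OF that] that by (simp add: b_def)
  have mb: "b (m u) = b u" if "u \<in> K" for u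
    using m that by (auto simp: b_def)
  have cards: "card ?A = card {u \<in> K. m u \<noteq> u}" "card ?B = card J" "card ?C = card J"
    by (intro card_image inj_onI; simp)+
  have disj: "?A \<inter> ?B = {}" "?A \<inter> ?C = {}" "?B \<inter> ?C = {}"
    using JK c m by auto
  have "card {u \<in> K. m u \<noteq> u} + 2 * card J = card (?A \<union> ?B \<union> ?C)"
    using cards disj fin by (simp add: card_Un_disjoint Int_Un_distrib2)
  also have "\<dots> \<le> card ?F"
  proof (rule card_mono)
    have "?F \<subseteq> verts G \<times> verts G" using E by auto
    then show "finite ?F" using G unfolding signed_graph_def by (meson finite_SigmaI finite_subset)
    show "?A \<union> ?B \<union> ?C \<subseteq> ?F"
      using um mb cb c by (auto simp: insert_commute)
  qed
  finally show thesis using that[OF H(1,2)] H(3) by linarith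
qed

lemma dstar_split_yes:
  assumes inst: "smc_instance G k" and split: "dstar_split d G"
    and large: "card (verts G) \<ge> 4 * (d + 1) * k"
  shows "smc_yes G k"
proof -
  let ?E = "edges G"
  have G: "signed_graph G" and conn: "connected_graph G" and k: "0 < k"
    using inst by (auto simp: smc_instance_def)
  obtain K I where V: "K \<union> I = verts G" "K \<inter> I = {}"
    and clique: "clique G K" and indep: "independent G I"
    and K_nbr: "\<forall>u\<in>K. \<exists>v\<in>I. {u, v} \<in> ?E" and I_deg: "\<forall>v\<in>I. deg G v \<le> d"
    using split unfolding dstar_split_def by blast
  have finV: "finite (verts G)" using G by (simp add: signed_graph_def)
  then have fin: "finite K" "finite I" using V(1) by (metis finite_Un)+
  have E: "u \<in> verts G \<and> v \<in> verts G" if "{u, v} \<in> ?E" for u v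
    using G that unfolding signed_graph_def by fastforce
  define N where "N v = {u. {u, v} \<in> ?E}" for v
  have NK: "N v \<subseteq> K" if "v \<in> I" for v
    using E V(1) indep that unfolding N_def independent_def by blast
  have cardV: "card (verts G) = card K + card I"
    using V fin by (metis card_Un_disjoint)
  have "4 * 1 * 1 \<le> 4 * (d + 1) * k" using k by (intro mult_le_mono) auto
  then have big: "4 \<le> card (verts G)" using large by linarith
  \<comment> \<open>A path to some other vertex starts with an edge at \<open>v\<close>.\<close>
  have N_ne: "N v \<noteq> {}" if v: "v \<in> verts G" for v
  proof -
    have "\<not> verts G \<subseteq> {v}"
      using big card_mono[of "{v}" "verts G"] by auto
    then obtain w where w: "w \<in> verts G" "w \<noteq> v" by blast
    have "(v, w) \<in> {(x, y). {x, y} \<in> ?E}\<^sup>*"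
      using conn v w(1) by (auto simp: connected_graph_def)
    then obtain z where "{v, z} \<in> ?E"
      using w(2) by (cases rule: converse_rtranclE) auto
    then show ?thesis by (auto simp: N_def insert_commute)
  qed
  have N_card: "card (N v) \<le> d" if "v \<in> I" for v
  proof -
    have "card (N v) = card ((\<lambda>u. {u, v}) ` N v)"
      by (intro card_image[symmetric] inj_onI) (auto simp: doubleton_eq_iff)
    also have "\<dots> \<le> deg G v"
      unfolding deg_def using finite_edges[OF G] by (intro card_mono) (auto simp: N_def)
    also have "\<dots> \<le> d" using I_deg that by blast
    finally show ?thesis .
  qed
  have "K \<subseteq> (\<Union>v\<in>I. N v)" using K_nbr by (auto simp: N_def)
  then have "card K \<le> card (\<Union>v\<in>I. N v)"
    using fin NK by (intro card_mono) (auto intro: finite_subset)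
  also have "\<dots> \<le> (\<Sum>v\<in>I. card (N v))" by (rule card_UN_le[OF fin(2)])
  also have "\<dots> \<le> card I * d" using sum_bounded_above[of I "\<lambda>v. card (N v)" d] N_card by simp
  finally have "(d + 1) * (4 * k) \<le> (d + 1) * card I"
    using large cardV by (simp add: algebra_simps)
  then have I: "4 * k \<le> card I" by (simp only: mult_le_cancel1)
  have N: "\<forall>v\<in>I. N v \<noteq> {} \<and> N v \<subseteq> K" using N_ne NK V(1) by blast
  \<comment> \<open>Four times the target is \<open>2 * m + n - 1 + k\<close> for \<open>m\<close>
    edges and \<open>n\<close> vertices; the 1 is moved to the right to avoid truncated
    subtraction.\<close>
  have "\<exists>m J. (\<forall>u\<in>K. m u \<in> K \<and> m (m u) = u) \<and> J \<subseteq> I \<and>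
      (\<forall>v\<in>J. \<exists>u\<in>N v. m u = u \<or> m u \<notin> N v) \<and>
      card K + card I + k \<le> card {u \<in> K. m u \<noteq> u} + 2 * card J + 1"
  proof (cases "odd (card K)")
    case True
    obtain m J where mJ: "\<forall>u\<in>K. m u \<in> K \<and> m (m u) = u" "J \<subseteq> I"
      "\<forall>v\<in>J. \<exists>u\<in>N v. m u = u \<or> m u \<notin> N v" "card {u \<in> K. m u \<noteq> u} + 1 = card K"
      "3 * card (I - J) \<le> card {v \<in> I. N v \<subseteq> K}"
      using good_matching[OF fin(1) subset_refl True fin(2) N] by blast
    \<comment> \<open>At most a third of \<open>I\<close> is lost, so \<open>2 * card J\<close> is
      at least \<open>4 / 3 * card I\<close>, hence at least \<open>card I + k\<close>; the summand
      1 pays for the unmatched vertex.\<close>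
    have "card {v \<in> I. N v \<subseteq> K} \<le> card I" using fin(2) by (intro card_mono) auto
    moreover have "card (I - J) + card J = card I"
      using mJ(2) fin(2) by (metis card_Diff_subset card_mono finite_subset le_add_diff_inverse2)
    ultimately have "card K + card I + k \<le> card {u \<in> K. m u \<noteq> u} + 2 * card J + 1"
      using mJ(4,5) I by linarith
    then show ?thesis using mJ by blast
  next
    case False
    obtain v0 where "v0 \<in> I" using I k by fastforce
    then obtain z where z: "z \<in> K" using N by blast
    \<comment> \<open>Leaving out \<open>z\<close> costs a second unmatched vertex. Its neighbour
      \<open>v\<close> is never bad, so \<open>3 * card (I - J) < card I\<close>; with
      \<open>4 * k \<le> card I\<close> and \<open>k \<ge> 1\<close> this yields
      \<open>2 * card J \<ge> card I + k + 1\<close>.\<close>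
    obtain v where v: "v \<in> I" "z \<in> N v" using K_nbr z by (auto simp: N_def)
    have K': "card (K - {z}) + 1 = card K" using card.remove[OF fin(1) z] by simp
    then have "odd (card (K - {z}))" using False by presburger
    then obtain m J where mJ: "\<forall>u\<in>K. m u \<in> K \<and> m (m u) = u" "J \<subseteq> I"
      "\<forall>v\<in>J. \<exists>u\<in>N v. m u = u \<or> m u \<notin> N v" "card {u \<in> K. m u \<noteq> u} + 1 = card (K - {z})"
      "3 * card (I - J) \<le> card {v \<in> I. N v \<subseteq> K - {z}}"
      using good_matching[OF fin(1) Diff_subset _ fin(2) N] by blast
    have "card {v \<in> I. N v \<subseteq> K - {z}} \<le> card (I - {v})"
      using fin(2) v by (intro card_mono) auto
    then have "card {v \<in> I. N v \<subseteq> K - {z}} + 1 \<le> card I"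
      using card.remove[OF fin(2) v(1)] by simp
    moreover have "card (I - J) + card J = card I"
      using mJ(2) fin(2) by (metis card_Diff_subset card_mono finite_subset le_add_diff_inverse2)
    ultimately have "card K + card I + k \<le> card {u \<in> K. m u \<noteq> u} + 2 * card J + 1"
      using mJ(4,5) I K' k by linarith
    then show ?thesis using mJ by blast
  qed
  then obtain m J where m: "\<forall>u\<in>K. m u \<in> K \<and> m (m u) = u" and J: "J \<subseteq> I"
      "\<forall>v\<in>J. \<exists>u\<in>N v. m u = u \<or> m u \<notin> N v"
    and gain: "card K + card I + k \<le> card {u \<in> K. m u \<noteq> u} + 2 * card J + 1"
    by blast
  have "\<forall>v\<in>J. \<exists>u. {u, v} \<in> ?E \<and> (m u = u \<or> {m u, v} \<notin> ?E)"
    using J(2) by (auto simp: N_def)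
  from balanced_subgraph_of_matching[OF G V clique indep m J(1) this]
  obtain H where H: "subgraph H G" "balanced H"
    "2 * card ?E + card {u \<in> K. m u \<noteq> u} + 2 * card J \<le> 4 * card (edges H)" by blast
  have "2 * card ?E + card (verts G) + k \<le> 4 * card (edges H) + 1"
    using H(3) gain cardV by linarith
  then have "real (2 * card ?E + card (verts G) + k) \<le> real (4 * card (edges H) + 1)"
    by (rule of_nat_mono)
  then have "real (card (edges H)) \<ge> real (card ?E) / 2 + (real (card (verts G)) - 1) / 4 + real k / 4"
    by (simp add: field_simps)
  then show ?thesis using inst H(1,2) by (auto simp: smc_yes_def)
qed

section \<open>Running time\<close>

fun pushes :: "nat \<Rightarrow> bool list \<Rightarrow> prog" where
  "pushes r [] = Skip"
| "pushes r (b # bs) = Seq (pushes r bs) (Push r b)"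

lemma exec_pushes: "exec (pushes r bs) s (length bs) (s(r := bs @ s r))"
proof (induction bs)
  case Nil
  show ?case using exec_Skip[of s] by simp
next
  case (Cons b bs)
  show ?case using exec_Seq[OF Cons.IH exec_Push[of r b]] by (simp del: fun_upd_apply add: fun_upd_same)
qed

definition clear :: "nat \<Rightarrow> prog" where
  "clear r = Loop (Nonempty r) (Pop r)"

lemma exec_clear: "exec (clear r) s (2 * length (s r) + 1) (s(r := []))"
proof (induction "s r" arbitrary: s)
  case Nil
  then have "s(r := []) = s" by auto
  then show ?case using Nil exec_LoopF[of "Nonempty r" s "Pop r"] by (simp add: clear_def)
next
  case (Cons b bs)
  let ?s = "s(r := tl (s r))"
  have "exec (clear r) ?s (2 * length bs + 1) (s(r := []))"
    using Cons.hyps(1)[of ?s] Cons.hyps(2) by (metis fun_upd_same fun_upd_upd list.sel(3))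
  then show ?case
    using exec_LoopT[OF _ exec_Pop[of r s], of "Nonempty r" "2 * length bs + 1" "s(r := [])"]
    by (auto simp: clear_def Cons.hyps(2)[symmetric])
qed

lemma ones_Suc: "replicate n True @ True # xs = True # replicate n True @ xs"
  by (induction n) auto

text \<open>The test is a parameter because a unary block ends either at the bottom of its stack
  (\<open>Nonempty\<close>) or at a \<open>False\<close> (\<open>TopOne\<close>).\<close>

definition move_ones :: "test \<Rightarrow> nat \<Rightarrow> nat \<Rightarrow> prog \<Rightarrow> prog" where
  "move_ones b r q c = Loop b (Seq (Pop r) (Seq (Push q True) c))"

text \<open>Each round costs a test, a pop, a push and \<open>T\<close> steps of \<open>c\<close>;
  the final 1 is the failing test. As \<open>c\<close> touches only the third stack
  \<open>p\<close>, its effects accumulate as iterates of \<open>f\<close>.\<close>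

lemma exec_move_ones:
  assumes "\<And>s n. s r = replicate n True @ xs \<Longrightarrow> test_val b s \<longleftrightarrow> n > 0"
    and "\<And>s. exec c s T (s(p := f (s p)))"
    and "r \<noteq> q" "p \<noteq> r" "p \<noteq> q"
    and "s r = replicate n True @ xs"
  shows "exec (move_ones b r q c) s (n * (T + 3) + 1)
    (s(r := xs, q := replicate n True @ s q, p := (f ^^ n) (s p)))"
  using assms(6)
proof (induction n arbitrary: s)
  case 0
  then have "s(r := xs, q := replicate 0 True @ s q, p := (f ^^ 0) (s p)) = s" by auto
  then show ?case
    using 0 assms(1)[of s 0] exec_LoopF[of b s]
    by (simp add: move_ones_def del: fun_upd_apply)
next
  case (Suc n)
  let ?s = "s(r := replicate n True @ xs, q := True # s q, p := f (s p))"
  have b: "test_val b s" using assms(1)[of s "Suc n"] Suc.prems by simp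
  have "exec (Seq (Pop r) (Seq (Push q True) c)) s (1 + (1 + T)) ?s"
    using exec_Seq[OF exec_Pop[of r s] exec_Seq[OF exec_Push[of q True] assms(2)]] Suc.prems assms(3-5)
    by simp
  moreover have "exec (move_ones b r q c) ?s (n * (T + 3) + 1)
    (?s(r := xs, q := replicate n True @ ?s q, p := (f ^^ n) (?s p)))"
    using Suc.IH[of ?s] assms(3-5)
    by (simp del: fun_upd_apply add: fun_upd_same fun_upd_other)
  ultimately have "exec (move_ones b r q c) s (Suc (1 + (1 + T) + (n * (T + 3) + 1)))
    (?s(r := xs, q := replicate n True @ ?s q, p := (f ^^ n) (?s p)))"
    using exec_LoopT[OF b] unfolding move_ones_def by blast
  moreover have "?s(r := xs, q := replicate n True @ ?s q, p := (f ^^ n) (?s p)) =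
     s(r := xs, q := replicate (Suc n) True @ s q, p := (f ^^ Suc n) (s p))"
    using assms(3-5) by (auto simp: fun_eq_iff ones_Suc funpow_swap1)
  moreover have "Suc (1 + (1 + T) + (n * (T + 3) + 1)) = Suc n * (T + 3) + 1" by simp
  ultimately show ?case by metis
qed

lemma exec_move_ones_Skip:
  assumes "\<And>s n. s r = replicate n True @ xs \<Longrightarrow> test_val b s \<longleftrightarrow> n > 0"
    and "r \<noteq> q" and "s r = replicate n True @ xs"
  shows "exec (move_ones b r q Skip) s (n * 3 + 1) (s(r := xs, q := replicate n True @ s q))"
proof -
  \<comment> \<open>Any stack other than \<open>r\<close> and \<open>q\<close> can carry the
    identity action of \<open>Skip\<close>; this index exceeds both.\<close>
  let ?p = "Suc (r + q)"
  have "((\<lambda>l. l) ^^ n) l = l" for l :: "bool list"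
    by (induction n) auto
  then have "s(r := xs, q := replicate n True @ s q, ?p := ((\<lambda>l. l) ^^ n) (s ?p)) =
      s(r := xs, q := replicate n True @ s q)"
    by (auto simp: fun_eq_iff)
  moreover have "exec Skip s' 0 (s'(?p := s' ?p))" for s'
    using exec_Skip by simp
  ultimately show ?thesis
    using exec_move_ones[of r xs b Skip 0 ?p "\<lambda>l. l" q s n] assms by simp
qed

text \<open>Compares \<open>c * k\<close> with \<open>n\<close>: stack 5 receives \<open>c\<close> ones for each one of stack 1 and then loses one for each leading one
  of stack 0, so it ends up empty iff \<open>c * k \<le> n\<close>; stacks 0 and 1 are restored.\<close>

definition compare_prog :: "nat \<Rightarrow> prog" where
  "compare_prog c =
    Seq (move_ones (Nonempty 1) 1 4 (pushes 5 (replicate c True)))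
   (Seq (move_ones (TopOne 0) 0 3 (Pop 5))
   (Seq (move_ones (Nonempty 3) 3 0 Skip) (move_ones (Nonempty 4) 4 1 Skip)))"

lemma exec_compare_prog:
  assumes "s 0 = replicate n True @ False # xs" "s 1 = replicate k True"
    "s 3 = []" "s 4 = []" "s 5 = []"
  shows "exec (compare_prog c) s (k * (c + 3) + 1 + (n * 4 + 1 + (n * 3 + 1 + (k * 3 + 1))))
    (s(5 := replicate (c * k - n) True))"
proof -
  let ?c = "replicate c True"
  define s1 where "s1 = s(1 := [], 4 := replicate k True, 5 := replicate (c * k) True)"
  define s2 where "s2 = s1(0 := False # xs, 3 := replicate n True, 5 := replicate (c * k - n) True)"
  define s3 where "s3 = s2(3 := [], 0 := replicate n True @ False # xs)"
  have "((\<lambda>l. ?c @ l) ^^ j) [] = replicate (c * j) True" for j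
    by (induction j) (auto simp: replicate_add)
  then have 1: "exec (move_ones (Nonempty 1) 1 4 (pushes 5 ?c)) s (k * (c + 3) + 1) s1"
    using exec_move_ones[of 1 "[]" "Nonempty 1" "pushes 5 ?c" c 5 "\<lambda>l. ?c @ l" 4 s k]
      exec_pushes[of 5 ?c] assms unfolding s1_def by simp
  \<comment> \<open>Popping an empty stack leaves it empty, in agreement with the truncated
    difference \<open>c * k - n\<close>.\<close>
  have tl: "(tl ^^ j) l = drop j l" for j and l :: "bool list"
    by (induction j arbitrary: l) (auto simp: drop_Suc drop_tl)
  have 2: "exec (move_ones (TopOne 0) 0 3 (Pop 5)) s1 (n * 4 + 1) s2"
    using exec_move_ones[of 0 "False # xs" "TopOne 0" "Pop 5" 1 5 tl 3 s1 n] exec_Pop[of 5] assms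
    unfolding s2_def by (auto simp: s1_def tl hd_append)
  have 3: "exec (move_ones (Nonempty 3) 3 0 Skip) s2 (n * 3 + 1) s3"
    using exec_move_ones_Skip[of 3 "[]" "Nonempty 3" 0 s2 n]
    by (simp add: s2_def s3_def)
  have 4: "exec (move_ones (Nonempty 4) 4 1 Skip) s3 (k * 3 + 1)
      (s3(4 := [], 1 := replicate k True))"
    using exec_move_ones_Skip[of 4 "[]" "Nonempty 4" 1 s3 k]
    by (simp add: s1_def s2_def s3_def)
  have "s3(4 := [], 1 := replicate k True) = s(5 := replicate (c * k - n) True)"
    using assms by (auto simp: fun_eq_iff s1_def s2_def s3_def)
  then show ?thesis
    using exec_Seq[OF 1 exec_Seq[OF 2 exec_Seq[OF 3 4]]] by (simp add: compare_prog_def)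
qed

text \<open>Serves both kernelizations, which differ only in the fixed outcome \<open>out\<close>
  for large graphs. The comparison restores stacks 0 and 1, so below the threshold the input is
  already the output.\<close>

lemma poly_time_threshold:
  assumes "\<And>s. s 2 = [] \<Longrightarrow> \<exists>t s'. exec c s t s' \<and> t \<le> a + 2 * (length (s 0) + length (s 1)) \<and>
    outputs (smc_split_problem d) s' out"
  shows "poly_time (smc_split_problem d) (\<lambda>G k. if b * k \<le> card (verts G) then out else Reduced G k)"
  unfolding poly_time_def
proof (intro exI[of _ "Seq (compare_prog b) (Branch (Nonempty 5) Skip c)"]
    exI[of _ "[:a + 5, b + 15:]"] ballI, clarify)
  fix G :: "nat sgraph" and k :: nat
  let ?P = "smc_split_problem d" and ?A = "\<lambda>G k. if b * k \<le> card (verts G) then out else Reduced G k"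
  define n where "n = card (verts G)"
  define L where "L = length (encode ?P G) + k"
  define s where "s = init_stacks ?P G k"
  define s' where "s' = s(5 := replicate (b * k - n) True)"
  obtain xs where enc: "encode ?P G = replicate n True @ False # xs"
    by (simp add: smc_split_problem_def encode_sgraph_def Let_def n_def)
  have s: "s 0 = encode ?P G" "s 1 = replicate k True" "s 2 = []" "s 3 = []" "s 4 = []" "s 5 = []"
    by (auto simp: s_def init_stacks_def)
  have compare: "exec (compare_prog b) s (k * (b + 3) + 1 + (n * 4 + 1 + (n * 3 + 1 + (k * 3 + 1)))) s'"
    unfolding s'_def using s enc by (intro exec_compare_prog) auto
  have "\<exists>t s''. exec (Branch (Nonempty 5) Skip c) s' t s'' \<and> t \<le> 1 + a + 2 * L \<and> outputs ?P s'' (?A G k)"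
  proof (cases "b * k \<le> n")
    case True
    then have nt: "\<not> test_val (Nonempty 5) s'" by (simp add: s'_def)
    have "s' 2 = []" using s by (simp add: s'_def)
    then obtain t s'' where "exec c s' t s''" "t \<le> a + 2 * (length (s' 0) + length (s' 1))"
      "outputs ?P s'' out" using assms by blast
    moreover have "length (s' 0) + length (s' 1) = L" using s by (simp add: s'_def L_def)
    ultimately show ?thesis
      using exec_BranchF[OF nt, of c t s'' Skip] True by (intro exI[of _ "Suc t"] exI[of _ s'']) (simp add: n_def)
  next
    case False
    then have nt: "test_val (Nonempty 5) s'" by (simp add: s'_def)
    have "outputs ?P s' (?A G k)" using False s by (simp add: s'_def n_def)
    then show ?thesis
      using exec_BranchT[OF nt exec_Skip, of c] by (intro exI[of _ "Suc 0"] exI[of _ s']) simp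
  qed
  then obtain t s'' where t: "exec (Branch (Nonempty 5) Skip c) s' t s''" "t \<le> 1 + a + 2 * L"
    "outputs ?P s'' (?A G k)" by blast
  \<comment> \<open>The comparison takes \<open>k * b + 6 * k + 7 * n + 4\<close> steps, at most
    \<open>b * L + 7 * L + 4\<close>; the branch adds at most \<open>1 + a + 2 * L\<close>.\<close>
  have "k * b \<le> L * b" by (intro mult_le_mono1) (simp add: L_def)
  moreover have "n + k \<le> L" by (simp add: L_def enc)
  ultimately have "k * (b + 3) + 1 + (n * 4 + 1 + (n * 3 + 1 + (k * 3 + 1))) + t \<le> poly [:a + 5, b + 15:] L"
    using t(2) by (simp only: poly_pCons poly_0 distrib_left)
  then show "\<exists>t s. exec (Seq (compare_prog b) (Branch (Nonempty 5) Skip c)) (init_stacks ?P G k) t s \<and>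
      t \<le> poly [:a + 5, b + 15:] (length (encode ?P G) + k) \<and> outputs ?P s (?A G k)"
    using exec_Seq[OF compare t(1)] t(3) unfolding s_def L_def by blast
qed

section \<open>A fixed Yes-instance\<close>

definition edge_graph :: "nat sgraph" where
  "edge_graph = \<lparr>verts = {0, 1}, pos = {{0, 1}}, neg = {}\<rparr>"

text \<open>The bound is attained: \<open>1 / 2 + 1 / 4 + 1 / 4 = 1\<close>, and the whole graph is
  balanced. The vertex in the independent part has degree 1, whence
  \<open>d \<ge> 1\<close>.\<close>

lemma edge_graph_yes:
  assumes "d \<ge> 1"
  shows "(edge_graph, 1) \<in> yes_insts (smc_split_problem d)"
proof -
  have verts: "verts edge_graph = {0, 1}" by (simp add: edge_graph_def)
  have edges: "edges edge_graph = {{0, 1}}" by (simp add: edges_def edge_graph_def)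
  have signed: "signed_graph edge_graph"
    unfolding signed_graph_def edges by (simp add: edge_graph_def)
  have "(0, 1) \<in> {(x, y). {x, y} \<in> edges edge_graph}\<^sup>*" "(1, 0) \<in> {(x, y). {x, y} \<in> edges edge_graph}\<^sup>*"
    by (auto simp: edges insert_commute)
  then have "connected_graph edge_graph"
    unfolding connected_graph_def by (simp add: edge_graph_def)
  then have inst: "smc_instance edge_graph 1"
    using signed by (simp add: smc_instance_def)
  have "balanced edge_graph"
    unfolding balanced_def edges
    by (intro exI[of _ "{0, 1}"] exI[of _ "{}"]) (simp add: edge_graph_def)
  moreover have "subgraph edge_graph edge_graph"
    using signed by (simp add: subgraph_def)
  ultimately have "smc_yes edge_graph 1"
    using inst unfolding smc_yes_def
    by (intro conjI exI[of _ edge_graph]) (simp_all add: edges verts)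
  moreover have "dstar_split d edge_graph"
  proof -
    have "{e. e = {0, 1} \<and> Suc 0 \<in> e} = {{0, 1}}" by auto
    then have "deg edge_graph 1 \<le> d" using assms by (simp add: deg_def edges)
    then show ?thesis
      unfolding dstar_split_def
      by (intro exI[of _ "{0}"] exI[of _ "{1}"])
        (auto simp: verts clique_def independent_def edges doubleton_eq_iff)
  qed
  moreover have "verts edge_graph = {..<card (verts edge_graph)}"
    by (auto simp: edge_graph_def)
  ultimately show ?thesis by (simp add: smc_split_problem_def)
qed

section \<open>The kernels\<close>

theorem theorem4p7:
  fixes d :: nat
  assumes "d \<ge> 1"
  shows "admits_kernel (smc_split_problem d) (\<lambda>G. card (verts G)) (\<lambda>k. 4 * (d + 1) * k) \<and>
    (\<forall>(G :: 'a sgraph) k. smc_instance G k \<and> dstar_split d G \<and>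
        card (verts G) \<ge> 4 * (d + 1) * k \<longrightarrow> smc_yes G k) \<and>
    kernelization (smc_split_problem d) (\<lambda>G. card (verts G)) (\<lambda>k. 4 * (d + 1) * k)
      (smc_split_alg d)"
proof (intro conjI)
  let ?P = "smc_split_problem d" and ?b = "4 * (d + 1)"
  have yes: "(G, k) \<in> yes_insts ?P" if "(G, k) \<in> insts ?P" "?b * k \<le> card (verts G)" for G k
    using that dstar_split_yes by (auto simp: smc_split_problem_def)
  \<comment> \<open>Positivity of \<open>k\<close> keeps the replacement instance admissible: its
    parameter 1 is at most \<open>k\<close>, and its two vertices are within the size bound.\<close>
  have pos: "0 < k" if "(G, k) \<in> insts ?P" for G k
    using that by (simp add: smc_split_problem_def smc_instance_def)
  show "\<forall>(G :: 'a sgraph) k. smc_instance G k \<and> dstar_split d G \<and>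
        card (verts G) \<ge> ?b * k \<longrightarrow> smc_yes G k"
    using dstar_split_yes by blast
  have "\<exists>t s'. exec (Push 2 True) s t s' \<and> t \<le> 1 + 2 * (length (s 0) + length (s 1)) \<and>
      outputs ?P s' (Answer True)" if "s 2 = []" for s
    using exec_Push[of 2 True s] that
    by (intro exI[of _ 1] exI[of _ "s(2 := True # s 2)"]) simp
  then have "poly_time ?P (smc_split_alg d)"
    using poly_time_threshold[of "Push 2 True" 1 d "Answer True" ?b] unfolding smc_split_alg_def by blast
  then show "kernelization ?P (\<lambda>G. card (verts G)) (\<lambda>k. ?b * k) (smc_split_alg d)"
    unfolding kernelization_def using yes by (auto simp: smc_split_alg_def)
  define A where "A = (\<lambda>G k. if ?b * k \<le> card (verts G) then Reduced edge_graph 1 else Reduced G k)"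
  let ?e = "encode ?P edge_graph"
  \<comment> \<open>The input is erased in linear time; writing the fixed instance and the unary
    parameter 1 takes constant time.\<close>
  let ?c = "Seq (clear 0) (Seq (clear 1) (Seq (pushes 0 ?e) (Push 1 True)))"
  have "\<exists>t s'. exec ?c s t s' \<and> t \<le> (length ?e + 3) + 2 * (length (s 0) + length (s 1)) \<and>
      outputs ?P s' (Reduced edge_graph 1)" if "s 2 = []" for s
  proof -
    note run = exec_Seq[OF exec_clear[of 0 s] exec_Seq[OF exec_clear[of 1 "s(0 := [])"]
      exec_Seq[OF exec_pushes[of 0 ?e "s(0 := [], 1 := [])"] exec_Push[of 1 True]]]]
    show ?thesis
      by (rule exI, rule exI, rule conjI[OF run]) (simp add: that)
  qed
  then have "poly_time ?P A"
    unfolding A_def by (rule poly_time_threshold)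
  moreover have "(edge_graph, 1) \<in> insts ?P"
    using edge_graph_yes[OF assms] by (auto simp: smc_split_problem_def smc_yes_def)
  moreover have "card (verts edge_graph) \<le> ?b * k" if "0 < k" for k
  proof -
    have "2 * 1 \<le> ?b * k" using that by (intro mult_le_mono) auto
    then show ?thesis by (simp add: edge_graph_def)
  qed
  ultimately have "kernelization ?P (\<lambda>G. card (verts G)) (\<lambda>k. ?b * k) A"
    unfolding kernelization_def using yes edge_graph_yes[OF assms] pos
    by (fastforce simp: A_def Suc_le_eq)
  then show "admits_kernel ?P (\<lambda>G. card (verts G)) (\<lambda>k. ?b * k)"
    unfolding admits_kernel_def by (intro exI[of _ A] conjI) (auto simp: A_def)
qed

end
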